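(* Let $R$ be a ring, and let $\sigma$ be a ring endomorphism of $R$. If the trivial extension $R\propto R(\sigma)$ is left morphic, then $R$ is unit regular.
   Context: All rings are associative with identity. For a ring $R$ and an $(R,R)$-bimodule $M$, the trivial extension $R\propto M$ is the set of pairs $(r,m)$ with $r\in R$, $m\in M$, with componentwise addition and multiplication $(r,m)(s,n)=(rs,rn+ms)$. For a ring endomorphism $\sigma$ of $R$, $R(\sigma)$ is the $(R,R)$-bimodule which equals ${}_RR$ as a left module and has right multiplication $s\cdot r=s\sigma(r)$ for $s\in R(\sigma)$, $r\in R$. An element $a$ of a ring $S$ is left morphic if $S/Sa\cong \{x\in S: xa=0\}$ as left $S$-modules; $S$ is left morphic if every element of $S$ is left morphic. A ring $R$ is unit regular if for every $a\in R$ there is a unit $u\in R$ with $a=aua$. *)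

theory Defs
  imports "HOL-Algebra.Module" "HOL-Algebra.QuotRing"
begin

text \<open>
  Left modules over a not necessarily commutative ring reuse the record type of
  HOL-Algebra modules, whose locale \<open>module\<close> demands a commutative ring of scalars.
  As there, the inherited fields \<open>mult\<close> and \<open>one\<close> of a module are irrelevant.
\<close>

locale left_module = R?: ring R + M?: abelian_group M
  for R :: "('r, 'k) ring_scheme" (structure)
    and M :: "('r, 'm, 'p) module_scheme" (structure) +
  assumes smult_closed:
      "\<lbrakk>r \<in> carrier R; x \<in> carrier M\<rbrakk> \<Longrightarrow> r \<odot>\<^bsub>M\<^esub> x \<in> carrier M"
    and smult_l_distr:
      "\<lbrakk>r \<in> carrier R; s \<in> carrier R; x \<in> carrier M\<rbrakk>
       \<Longrightarrow> (r \<oplus>\<^bsub>R\<^esub> s) \<odot>\<^bsub>M\<^esub> x = r \<odot>\<^bsub>M\<^esub> x \<oplus>\<^bsub>M\<^esub> s \<odot>\<^bsub>M\<^esub> x"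
    and smult_r_distr:
      "\<lbrakk>r \<in> carrier R; x \<in> carrier M; y \<in> carrier M\<rbrakk>
       \<Longrightarrow> r \<odot>\<^bsub>M\<^esub> (x \<oplus>\<^bsub>M\<^esub> y) = r \<odot>\<^bsub>M\<^esub> x \<oplus>\<^bsub>M\<^esub> r \<odot>\<^bsub>M\<^esub> y"
    and smult_assoc:
      "\<lbrakk>r \<in> carrier R; s \<in> carrier R; x \<in> carrier M\<rbrakk>
       \<Longrightarrow> (r \<otimes>\<^bsub>R\<^esub> s) \<odot>\<^bsub>M\<^esub> x = r \<odot>\<^bsub>M\<^esub> (s \<odot>\<^bsub>M\<^esub> x)"
    and smult_one: "x \<in> carrier M \<Longrightarrow> \<one>\<^bsub>R\<^esub> \<odot>\<^bsub>M\<^esub> x = x"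

definition left_module_hom ::
    "('r, 'k) ring_scheme \<Rightarrow> ('r, 'm, 'p) module_scheme \<Rightarrow> ('r, 'n, 'q) module_scheme
     \<Rightarrow> ('m \<Rightarrow> 'n) set"
  where "left_module_hom R M N =
    {h \<in> carrier M \<rightarrow> carrier N.
      (\<forall>x\<in>carrier M. \<forall>y\<in>carrier M. h (x \<oplus>\<^bsub>M\<^esub> y) = h x \<oplus>\<^bsub>N\<^esub> h y) \<and>
      (\<forall>r\<in>carrier R. \<forall>x\<in>carrier M. h (r \<odot>\<^bsub>M\<^esub> x) = r \<odot>\<^bsub>N\<^esub> h x)}"

definition left_module_isomorphic ::
    "('r, 'k) ring_scheme \<Rightarrow> ('r, 'm, 'p) module_scheme \<Rightarrow> ('r, 'n, 'q) module_scheme \<Rightarrow> bool"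
  where "left_module_isomorphic R M N \<longleftrightarrow>
    (\<exists>h \<in> left_module_hom R M N. bij_betw h (carrier M) (carrier N))"

record ('r, 'm) bimodule = "('r, 'm) module" +
  rsmult :: "['m, 'r] \<Rightarrow> 'm"

locale bimodule = left_module R M
  for R :: "('r, 'k) ring_scheme" (structure)
    and M :: "('r, 'm, 'p) bimodule_scheme" (structure) +
  assumes rsmult_closed:
      "\<lbrakk>r \<in> carrier R; x \<in> carrier M\<rbrakk> \<Longrightarrow> rsmult M x r \<in> carrier M"
    and rsmult_r_distr:
      "\<lbrakk>r \<in> carrier R; s \<in> carrier R; x \<in> carrier M\<rbrakk>
       \<Longrightarrow> rsmult M x (r \<oplus>\<^bsub>R\<^esub> s) = rsmult M x r \<oplus>\<^bsub>M\<^esub> rsmult M x s"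
    and rsmult_l_distr:
      "\<lbrakk>r \<in> carrier R; x \<in> carrier M; y \<in> carrier M\<rbrakk>
       \<Longrightarrow> rsmult M (x \<oplus>\<^bsub>M\<^esub> y) r = rsmult M x r \<oplus>\<^bsub>M\<^esub> rsmult M y r"
    and rsmult_assoc:
      "\<lbrakk>r \<in> carrier R; s \<in> carrier R; x \<in> carrier M\<rbrakk>
       \<Longrightarrow> rsmult M x (r \<otimes>\<^bsub>R\<^esub> s) = rsmult M (rsmult M x r) s"
    and rsmult_one: "x \<in> carrier M \<Longrightarrow> rsmult M x \<one>\<^bsub>R\<^esub> = x"
    and smult_rsmult_assoc:
      "\<lbrakk>r \<in> carrier R; s \<in> carrier R; x \<in> carrier M\<rbrakk>
       \<Longrightarrow> rsmult M (r \<odot>\<^bsub>M\<^esub> x) s = r \<odot>\<^bsub>M\<^esub> rsmult M x s"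

definition trivial_extension ::
    "('r, 'k) ring_scheme \<Rightarrow> ('r, 'm, 'p) bimodule_scheme \<Rightarrow> ('r \<times> 'm) ring"
    (infixl \<open>\<propto>\<close> 65)
  where "R \<propto> M =
    \<lparr>carrier = carrier R \<times> carrier M,
     mult = (\<lambda>(r, m) (s, n). (r \<otimes>\<^bsub>R\<^esub> s, r \<odot>\<^bsub>M\<^esub> n \<oplus>\<^bsub>M\<^esub> rsmult M m s)),
     one = (\<one>\<^bsub>R\<^esub>, \<zero>\<^bsub>M\<^esub>),
     zero = (\<zero>\<^bsub>R\<^esub>, \<zero>\<^bsub>M\<^esub>),
     add = (\<lambda>(r, m) (s, n). (r \<oplus>\<^bsub>R\<^esub> s, m \<oplus>\<^bsub>M\<^esub> n))\<rparr>"

definition twisted_bimodule ::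
    "('r, 'k) ring_scheme \<Rightarrow> ('r \<Rightarrow> 'r) \<Rightarrow> ('r, 'r) bimodule"
  where "twisted_bimodule R \<sigma> =
    \<lparr>carrier = carrier R, mult = mult R, one = \<one>\<^bsub>R\<^esub>,
     zero = \<zero>\<^bsub>R\<^esub>, add = add R,
     smult = (\<lambda>r s. r \<otimes>\<^bsub>R\<^esub> s),
     rsmult = (\<lambda>s r. s \<otimes>\<^bsub>R\<^esub> \<sigma> r)\<rparr>"

definition left_annihilator ::
    "('s, 'k) ring_scheme \<Rightarrow> 's \<Rightarrow> ('s, 's) module"
  where "left_annihilator S a =
    \<lparr>carrier = {x \<in> carrier S. x \<otimes>\<^bsub>S\<^esub> a = \<zero>\<^bsub>S\<^esub>},
     mult = mult S, one = \<one>\<^bsub>S\<^esub>, zero = \<zero>\<^bsub>S\<^esub>, add = add S,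
     smult = mult S\<rparr>"

text \<open>
  The left module \<open>S/I\<close> for a left ideal \<open>I\<close>. Scalar multiplication is the union of
  the cosets of \<open>r \<otimes> x\<close> over the representatives \<open>x\<close> of a coset, as in the library's
  \<open>rcoset_mult\<close>; it is a single coset by \<open>left_quotient_smult\<close> below.
\<close>

definition left_quotient ::
    "('s, 'k) ring_scheme \<Rightarrow> 's set \<Rightarrow> ('s, 's set) module"
  where "left_quotient S I =
    \<lparr>carrier = a_rcosets\<^bsub>S\<^esub> I,
     mult = (\<lambda>_ _. undefined), one = undefined,
     zero = I, add = set_add S,
     smult = (\<lambda>r X. \<Union>x\<in>X. I +>\<^bsub>S\<^esub> (r \<otimes>\<^bsub>S\<^esub> x))\<rparr>"

text \<open>Over a noncommutative ring, \<open>PIdl\<^bsub>S\<^esub> a\<close> is the left ideal \<open>Sa\<close>.\<close>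

definition left_morphic_elem :: "('s, 'k) ring_scheme \<Rightarrow> 's \<Rightarrow> bool"
  where "left_morphic_elem S a \<longleftrightarrow>
    left_module_isomorphic S (left_quotient S (PIdl\<^bsub>S\<^esub> a)) (left_annihilator S a)"

definition left_morphic_ring :: "('s, 'k) ring_scheme \<Rightarrow> bool"
  where "left_morphic_ring S \<longleftrightarrow> (\<forall>a\<in>carrier S. left_morphic_elem S a)"

definition unit_regular_ring :: "('r, 'k) ring_scheme \<Rightarrow> bool"
  where "unit_regular_ring R \<longleftrightarrow>
    (\<forall>a\<in>carrier R. \<exists>u\<in>Units R. a = a \<otimes>\<^bsub>R\<^esub> u \<otimes>\<^bsub>R\<^esub> a)"

lemma bimodule_twisted_bimodule:
  assumes "ring R" and s: "\<sigma> \<in> ring_hom R R"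
  shows "bimodule R (twisted_bimodule R \<sigma>)"
proof -
  interpret ring R by fact
  have "abelian_group (twisted_bimodule R \<sigma>)"
    by (rule abelian_groupI)
      (auto simp: twisted_bimodule_def a_ac intro: l_neg)
  then show ?thesis
    using ring_hom_closed[OF s] ring_hom_add[OF s] ring_hom_mult[OF s] ring_hom_one[OF s]
    by (intro bimodule.intro left_module.intro left_module_axioms.intro bimodule_axioms.intro)
      (auto simp: twisted_bimodule_def l_distr r_distr m_assoc ring_axioms)
qed

lemma (in bimodule) ring_trivial_extension: "ring (R \<propto> M)"
proof (rule ringI)
  show "abelian_group (R \<propto> M)"
  proof (rule abelian_groupI)
    fix x assume "x \<in> carrier (R \<propto> M)"
    then show "\<exists>y\<in>carrier (R \<propto> M). y \<oplus>\<^bsub>R \<propto> M\<^esub> x = \<zero>\<^bsub>R \<propto> M\<^esub>"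
      by (intro bexI[of _ "(\<ominus>\<^bsub>R\<^esub> fst x, \<ominus>\<^bsub>M\<^esub> snd x)"])
        (auto simp: trivial_extension_def R.l_neg M.l_neg)
  qed (auto simp: trivial_extension_def R.a_ac M.a_ac)
  have [simp]: "r \<odot>\<^bsub>M\<^esub> \<zero>\<^bsub>M\<^esub> = \<zero>\<^bsub>M\<^esub>" "rsmult M \<zero>\<^bsub>M\<^esub> r = \<zero>\<^bsub>M\<^esub>" if "r \<in> carrier R" for r
    using that smult_r_distr[of r "\<zero>\<^bsub>M\<^esub>" "\<zero>\<^bsub>M\<^esub>"] rsmult_l_distr[of r "\<zero>\<^bsub>M\<^esub>" "\<zero>\<^bsub>M\<^esub>"]
      smult_closed[of r "\<zero>\<^bsub>M\<^esub>"] rsmult_closed[of r "\<zero>\<^bsub>M\<^esub>"]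
    by simp_all
  show "Group.monoid (R \<propto> M)"
    by (rule monoidI)
      (auto simp: trivial_extension_def smult_closed rsmult_closed smult_one rsmult_one
        R.m_assoc smult_r_distr rsmult_l_distr smult_assoc rsmult_assoc smult_rsmult_assoc
        M.a_assoc)
qed (auto simp: trivial_extension_def smult_closed rsmult_closed R.l_distr R.r_distr
      smult_l_distr smult_r_distr rsmult_l_distr rsmult_r_distr M.a_ac)

lemma left_quotient_smult:
  fixes S (structure)
  assumes "ring S" and a: "a \<in> carrier S" and r: "r \<in> carrier S" and x: "x \<in> carrier S"
  shows "r \<odot>\<^bsub>left_quotient S (PIdl\<^bsub>S\<^esub> a)\<^esub> (PIdl\<^bsub>S\<^esub> a +>\<^bsub>S\<^esub> x) = PIdl\<^bsub>S\<^esub> a +>\<^bsub>S\<^esub> (r \<otimes>\<^bsub>S\<^esub> x)"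
proof -
  interpret ring S by fact
  let ?I = "PIdl\<^bsub>S\<^esub> a"
  have mem: "s \<otimes> a \<in> ?I" if "s \<in> carrier S" for s
    using that by (auto simp: cgenideal_def)
  have memE: "\<exists>s\<in>carrier S. y = s \<otimes> a" if "y \<in> ?I" for y
    using that by (auto simp: cgenideal_def)
  have I: "additive_subgroup ?I S"
  proof (intro additive_subgroup.intro add.subgroupI)
    show "?I \<subseteq> carrier S" using memE a by blast
    show "?I \<noteq> {}" using mem by blast
  next
    fix y assume "y \<in> ?I"
    then obtain s where "s \<in> carrier S" "y = s \<otimes> a" using memE by blast
    then show "\<ominus> y \<in> ?I" using mem[of "\<ominus> s"] a by (simp add: l_minus)
  next
    fix y z assume "y \<in> ?I" "z \<in> ?I"
    then obtain s t where "s \<in> carrier S" "y = s \<otimes> a" "t \<in> carrier S" "z = t \<otimes> a"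
      using memE by meson
    then show "y \<oplus> z \<in> ?I" using mem[of "s \<oplus> t"] a by (simp add: l_distr)
  qed
  interpret abelian_subgroup ?I S
    by (rule abelian_subgroupI3[OF I is_abelian_group])
  have rI: "r \<otimes> i \<in> ?I" if i: "i \<in> ?I" for i
  proof -
    from memE[OF i] obtain s where "s \<in> carrier S" "i = s \<otimes> a" by blast
    then show ?thesis using mem[of "r \<otimes> s"] a r by (simp add: m_assoc)
  qed
  have "?I +> (r \<otimes> y) = ?I +> (r \<otimes> x)" if "y \<in> ?I +> x" for y
  proof -
    from that obtain i where i: "i \<in> ?I" "y = i \<oplus> x" by (auto simp: a_r_coset_def')
    then have "r \<otimes> y = r \<otimes> i \<oplus> r \<otimes> x" using r x a_Hcarr by (simp add: r_distr)
    then have "r \<otimes> y \<in> ?I +> (r \<otimes> x)" using rI[OF i(1)] by (auto simp: a_r_coset_def')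
    then show ?thesis using a_repr_independence[OF _ _ a_subgroup] r x by simp
  qed
  moreover have "x \<in> ?I +> x" using a_rcos_self x by blast
  ultimately have "(\<Union>y\<in>?I +> x. ?I +> (r \<otimes> y)) = ?I +> (r \<otimes> x)" by blast
  then show ?thesis by (simp add: left_quotient_def)
qed

end

theory Submission
  imports Defs
begin

text \<open>
  An element \<open>a\<close> of \<open>S\<close> is left morphic only if some \<open>b\<close> has \<open>Sa = l(b)\<close> and \<open>Sb = l(a)\<close>, where
  \<open>l\<close> is the left annihilator. Applied to \<open>(0, a)\<close> in \<open>R \<propto> R(\<sigma>)\<close>, this gives \<open>b, c \<in> R\<close> with
  \<open>Rb = l(a)\<close>, \<open>l(\<sigma> b) = Ra\<close> and \<open>l(b)c \<oplus> R\<sigma>(b) = R\<close>, the map \<open>r \<mapsto> rc\<close> being injective on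
  \<open>l(b)\<close>. Hence \<open>R\<sigma>(b)\<close> is a direct summand, so \<open>\<sigma> b\<close> and with it \<open>a\<close> are regular.

  If \<open>a = axa\<close>, put \<open>e = 1 - xa\<close> and \<open>f = 1 - ax\<close>. Then \<open>Rf = l(a) = Rb\<close>, so
  \<open>Re \<cong> R/Ra = R/l(\<sigma> b) \<cong> R\<sigma>(b) = R\<sigma>(f)\<close>. The same argument for the idempotent \<open>ax\<close> in
  place of \<open>a\<close> gives \<open>Rf \<cong> R\<sigma>(f)\<close>. Therefore \<open>Re \<cong> Rf\<close>, which is Ehrlich's criterion for the
  regular element \<open>a\<close> to be unit regular.
\<close>

context ring
begin

section \<open>Left morphic elements in terms of annihilators\<close>

lemma additive_subgroup_cgenideal:
  assumes a: "a \<in> carrier R"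
  shows "additive_subgroup (PIdl a) R"
proof (intro additive_subgroup.intro add.subgroupI)
  show "PIdl a \<subseteq> carrier R" "PIdl a \<noteq> {}"
    using a by (auto simp: cgenideal_def)
next
  fix y assume "y \<in> PIdl a"
  then obtain s where "s \<in> carrier R" "y = s \<otimes> a" by (auto simp: cgenideal_def)
  then have "\<ominus> s \<in> carrier R" "\<ominus> y = \<ominus> s \<otimes> a" using a by (simp_all add: l_minus)
  then show "\<ominus> y \<in> PIdl a" by (auto simp: cgenideal_def)
next
  fix y z assume "y \<in> PIdl a" "z \<in> PIdl a"
  then obtain s t where "s \<in> carrier R" "y = s \<otimes> a" "t \<in> carrier R" "z = t \<otimes> a"
    by (auto simp: cgenideal_def)
  then have "s \<oplus> t \<in> carrier R" "y \<oplus> z = (s \<oplus> t) \<otimes> a" using a by (simp_all add: l_distr)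
  then show "y \<oplus> z \<in> PIdl a" by (auto simp: cgenideal_def)
qed

text \<open>The coset of \<open>\<one>\<close> generates \<open>R/Ra\<close>, so an isomorphism
  \<open>h\<close> onto the annihilator of \<open>a\<close> is right multiplication by its image
  \<open>b\<close> of that coset. Surjectivity of \<open>h\<close> identifies \<open>Rb\<close>,
  injectivity identifies the annihilator of \<open>b\<close>.\<close>

lemma left_morphic_elem_annihilators:
  assumes a: "a \<in> carrier R" and morphic: "left_morphic_elem R a"
  obtains b where "b \<in> carrier R"
    and "PIdl a = {x \<in> carrier R. x \<otimes> b = \<zero>}"
    and "PIdl b = {x \<in> carrier R. x \<otimes> a = \<zero>}"
proof -
  let ?I = "PIdl a" and ?Q = "left_quotient R (PIdl a)" and ?L = "left_annihilator R a"
  interpret I: abelian_subgroup ?I R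
    by (rule abelian_subgroupI3[OF additive_subgroup_cgenideal[OF a] is_abelian_group])
  from morphic obtain h where h: "h \<in> left_module_hom R ?Q ?L"
    and bij: "bij_betw h (carrier ?Q) (carrier ?L)"
    unfolding left_morphic_elem_def left_module_isomorphic_def by blast
  define b where "b = h (?I +> \<one>)"
  have Q: "carrier ?Q = (\<lambda>x. ?I +> x) ` carrier R"
    by (auto simp: left_quotient_def A_RCOSETS_def')
  have L: "carrier ?L = {x \<in> carrier R. x \<otimes> a = \<zero>}"
    by (simp add: left_annihilator_def)
  have hx: "h (?I +> x) = x \<otimes> b" if x: "x \<in> carrier R" for x
  proof -
    have "h (x \<odot>\<^bsub>?Q\<^esub> (?I +> \<one>)) = x \<odot>\<^bsub>?L\<^esub> h (?I +> \<one>)"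
      using h x Q unfolding left_module_hom_def by blast
    then show ?thesis
      using left_quotient_smult[OF ring_axioms a x one_closed] x
      by (simp add: b_def left_annihilator_def)
  qed
  have hL: "h ` carrier ?Q = carrier ?L" using bij by (simp add: bij_betw_def)
  have "b \<in> h ` carrier ?Q" unfolding b_def Q by blast
  then have b: "b \<in> carrier R" unfolding hL L by blast
  have "PIdl b = (\<lambda>x. x \<otimes> b) ` carrier R"
    unfolding cgenideal_def by blast
  also have "\<dots> = (\<lambda>x. h (?I +> x)) ` carrier R"
    by (rule image_cong[OF refl]) (rule hx[symmetric])
  also have "\<dots> = {x \<in> carrier R. x \<otimes> a = \<zero>}"
    using hL unfolding Q L image_image .
  finally have "PIdl b = {x \<in> carrier R. x \<otimes> a = \<zero>}" .
  moreover have "x \<in> ?I \<longleftrightarrow> x \<otimes> b = \<zero>" if x: "x \<in> carrier R" for x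
  proof -
    have I0: "?I +> \<zero> = ?I"
      using a_coset_add_zero I.a_subset by blast
    have "x \<otimes> b = \<zero> \<longleftrightarrow> h (?I +> x) = h (?I +> \<zero>)"
      unfolding hx[OF x] hx[OF zero_closed] using b by simp
    also have "\<dots> \<longleftrightarrow> ?I +> x = ?I +> \<zero>"
      using x by (intro inj_on_eq_iff[OF bij_betw_imp_inj_on[OF bij]]) (auto simp: Q)
    also have "\<dots> \<longleftrightarrow> x \<in> ?I"
      unfolding I0 using I.a_rcos_self[OF x] I.a_rcos_const by blast
    finally show ?thesis by simp
  qed
  ultimately show thesis
    using that[OF b] I.a_subset by blast
qed

section \<open>Equivalent idempotents and Ehrlich's criterion\<close>

text \<open>For idempotents, this says \<open>Re \<cong> Rf\<close>, by right multiplication with \<open>u\<close> and \<open>v\<close>.\<close>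

definition idempotents_equivalent :: "'a \<Rightarrow> 'a \<Rightarrow> bool"
  where "idempotents_equivalent e f \<longleftrightarrow>
    (\<exists>u\<in>carrier R. \<exists>v\<in>carrier R. e \<otimes> u = u \<and> u \<otimes> f = u \<and> f \<otimes> v = v \<and> v \<otimes> e = v
      \<and> u \<otimes> v = e \<and> v \<otimes> u = f)"

lemma idempotents_equivalent_sym:
  "idempotents_equivalent e f \<Longrightarrow> idempotents_equivalent f e"
  unfolding idempotents_equivalent_def by blast

lemma idempotents_equivalent_trans:
  assumes "idempotents_equivalent e f" "idempotents_equivalent f g"
    and "e \<in> carrier R" "f \<in> carrier R" "g \<in> carrier R"
  shows "idempotents_equivalent e g"
proof -
  obtain u v where uv: "u \<in> carrier R" "v \<in> carrier R" "e \<otimes> u = u" "u \<otimes> f = u"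
      "f \<otimes> v = v" "v \<otimes> e = v" "u \<otimes> v = e" "v \<otimes> u = f"
    using assms(1) unfolding idempotents_equivalent_def by blast
  obtain w z where wz: "w \<in> carrier R" "z \<in> carrier R" "f \<otimes> w = w" "w \<otimes> g = w"
      "g \<otimes> z = z" "z \<otimes> f = z" "w \<otimes> z = f" "z \<otimes> w = g"
    using assms(2) unfolding idempotents_equivalent_def by blast
  have "u \<otimes> w \<otimes> (z \<otimes> v) = u \<otimes> (w \<otimes> z) \<otimes> v"
    using uv(1,2) wz(1,2) by (simp only: m_assoc m_closed)
  then have "u \<otimes> w \<otimes> (z \<otimes> v) = e" using uv wz by simp
  moreover have "z \<otimes> v \<otimes> (u \<otimes> w) = z \<otimes> (v \<otimes> u) \<otimes> w"
    using uv(1,2) wz(1,2) by (simp only: m_assoc m_closed)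
  then have "z \<otimes> v \<otimes> (u \<otimes> w) = g" using uv wz by simp
  moreover have "e \<otimes> (u \<otimes> w) = u \<otimes> w" "u \<otimes> w \<otimes> g = u \<otimes> w"
      "g \<otimes> (z \<otimes> v) = z \<otimes> v" "z \<otimes> v \<otimes> e = z \<otimes> v"
    using uv wz assms(3-) m_assoc by (metis, metis, metis, metis)
  ultimately show ?thesis
    unfolding idempotents_equivalent_def
    using uv(1,2) wz(1,2) by (intro bexI[of _ "u \<otimes> w"] bexI[of _ "z \<otimes> v"]) auto
qed

text \<open>With \<open>e = 1 - xa\<close> and \<open>f = 1 - ax\<close>, \<open>R\<close> splits
  both as \<open>Rxa + Re\<close> and as \<open>Rax + Rf\<close>. Right multiplication by
  \<open>xax\<close> maps \<open>Rxa\<close> onto \<open>Rax\<close> with inverse \<open>a\<close>,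
  and the equivalence maps \<open>Re\<close> onto \<open>Rf\<close>. The two isomorphisms glue to an
  automorphism of \<open>R\<close>, hence to a unit.\<close>

lemma unit_regular_elem_if_equivalent:
  assumes a: "a \<in> carrier R" and x: "x \<in> carrier R" and axa: "a \<otimes> x \<otimes> a = a"
    and eq: "idempotents_equivalent (\<one> \<ominus> x \<otimes> a) (\<one> \<ominus> a \<otimes> x)"
  shows "\<exists>u\<in>Units R. a = a \<otimes> u \<otimes> a"
proof -
  define e f where "e = \<one> \<ominus> x \<otimes> a" and "f = \<one> \<ominus> a \<otimes> x"
  obtain u v where uv: "u \<in> carrier R" "v \<in> carrier R" "e \<otimes> u = u" "u \<otimes> f = u"
      "f \<otimes> v = v" "v \<otimes> e = v" "u \<otimes> v = e" "v \<otimes> u = f"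
    using eq unfolding idempotents_equivalent_def e_def f_def by blast
  have ef: "e \<in> carrier R" "f \<in> carrier R" using a x by (simp_all add: e_def f_def)
  have ae: "a \<otimes> e = \<zero>" and fa: "f \<otimes> a = \<zero>"
    using a x axa by (simp_all add: e_def f_def minus_eq r_distr l_distr r_minus l_minus
        m_assoc[symmetric] r_neg)
  have exa: "e \<otimes> x \<otimes> a = \<zero>"
  proof -
    have "e \<otimes> x \<otimes> a = x \<otimes> a \<ominus> x \<otimes> (a \<otimes> x \<otimes> a)"
      using a x unfolding e_def by (algebra; simp)
    then show ?thesis using a x axa by (simp add: minus_eq r_neg)
  qed
  have axf: "a \<otimes> x \<otimes> f = \<zero>"
  proof -
    have "a \<otimes> x \<otimes> f = a \<otimes> x \<ominus> (a \<otimes> x \<otimes> a) \<otimes> x"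
      using a x unfolding f_def by (algebra; simp)
    then show ?thesis using a x axa by (simp add: minus_eq r_neg)
  qed
  \<comment> \<open>Each piece kills the other summand, so the mixed terms of the products below
    vanish.\<close>
  have ua: "u \<otimes> a = \<zero>" and au: "a \<otimes> u = \<zero>"
    and vxa: "v \<otimes> x \<otimes> a = \<zero>" and axv: "a \<otimes> x \<otimes> v = \<zero>"
  proof -
    have "u \<otimes> a = u \<otimes> (f \<otimes> a)" "a \<otimes> u = a \<otimes> e \<otimes> u"
      using uv ef a m_assoc by metis+
    then show "u \<otimes> a = \<zero>" "a \<otimes> u = \<zero>" using ae fa uv by simp_all
    have "v \<otimes> x \<otimes> a = v \<otimes> (e \<otimes> x \<otimes> a)" "a \<otimes> x \<otimes> v = a \<otimes> x \<otimes> f \<otimes> v"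
      using uv(1,2,5,6) ef a x by (metis m_assoc m_closed)+
    then show "v \<otimes> x \<otimes> a = \<zero>" "a \<otimes> x \<otimes> v = \<zero>" using exa axf uv by simp_all
  qed
  \<comment> \<open>The glued map and its inverse. The reflexive inverse \<open>xax\<close> replaces
    \<open>x\<close>, because \<open>x\<close> itself need not kill \<open>Re\<close>.\<close>
  let ?U = "x \<otimes> a \<otimes> x \<oplus> u" and ?V = "a \<oplus> v"
  have "?U \<otimes> ?V = x \<otimes> (a \<otimes> x \<otimes> a) \<oplus> x \<otimes> (a \<otimes> x \<otimes> v) \<oplus> u \<otimes> a \<oplus> u \<otimes> v"
    using a x uv(1,2) by algebra
  also have "\<dots> = \<one>"
    using a x axa axv ua uv(7) unfolding e_def by (simp add: minus_eq) algebra
  finally have UV: "?U \<otimes> ?V = \<one>" .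
  have "?V \<otimes> ?U = a \<otimes> x \<otimes> a \<otimes> x \<oplus> a \<otimes> u \<oplus> v \<otimes> x \<otimes> a \<otimes> x \<oplus> v \<otimes> u"
    using a x uv(1,2) by algebra
  also have "\<dots> = \<one>"
    using a x axa vxa au uv(8) unfolding f_def by (simp add: minus_eq) algebra
  finally have VU: "?V \<otimes> ?U = \<one>" .
  have "?U \<in> Units R"
    using UV VU a x uv(1,2) unfolding Units_def by (intro CollectI conjI bexI[of _ ?V]) auto
  moreover have "a \<otimes> ?U \<otimes> a = a \<otimes> x \<otimes> a \<otimes> x \<otimes> a \<oplus> a \<otimes> u \<otimes> a"
    using a x uv(1) by algebra
  then have "a \<otimes> ?U \<otimes> a = a" using a axa au by simp
  ultimately show ?thesis by metis
qed

end

section \<open>Rings with left morphic twisted trivial extension\<close>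

locale morphic_twisted_extension = ring R for R (structure) +
  fixes \<sigma>
  assumes hom: "\<sigma> \<in> ring_hom R R"
    and morphic: "left_morphic_ring (R \<propto> twisted_bimodule R \<sigma>)"
begin

lemmas \<sigma>_closed [simp, intro] = ring_hom_closed[OF hom]

lemma \<sigma>_zero [simp]: "\<sigma> \<zero> = \<zero>"
  using ring_hom_zero[OF hom ring_axioms ring_axioms] .

text \<open>Here \<open>(b, c)\<close> is the partner of \<open>(\<zero>, a)\<close> given by
  \<open>left_morphic_elem_annihilators\<close>, and both of its equations are read off in
  coordinates. The last three conclusions express that \<open>l(b)c\<close> and
  \<open>R\<sigma>(b)\<close> are complementary and that \<open>c\<close> acts injectively on
  \<open>l(b)\<close>.\<close>

lemma annihilator_data:
  assumes a: "a \<in> carrier R"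
  obtains b c r m where "b \<in> carrier R" "c \<in> carrier R" "r \<in> carrier R" "m \<in> carrier R"
    and "PIdl b = {x \<in> carrier R. x \<otimes> a = \<zero>}"
    and "PIdl a = {x \<in> carrier R. x \<otimes> \<sigma> b = \<zero>}"
    and "r \<otimes> b = \<zero>" and "r \<otimes> c \<oplus> m \<otimes> \<sigma> b = \<one>"
    and "\<forall>x\<in>carrier R. \<forall>y\<in>carrier R.
      x \<otimes> b = \<zero> \<longrightarrow> x \<otimes> c \<oplus> y \<otimes> \<sigma> b = \<zero> \<longrightarrow> x = \<zero>"
proof -
  let ?S = "R \<propto> twisted_bimodule R \<sigma>"
  interpret bimodule R "twisted_bimodule R \<sigma>"
    by (rule bimodule_twisted_bimodule[OF ring_axioms hom])
  interpret S: ring ?S by (rule ring_trivial_extension)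
  have S: "carrier ?S = carrier R \<times> carrier R" "\<zero>\<^bsub>?S\<^esub> = (\<zero>, \<zero>)"
    and mult: "(x, y) \<otimes>\<^bsub>?S\<^esub> (z, w) = (x \<otimes> z, x \<otimes> w \<oplus> y \<otimes> \<sigma> z)" for x y z w
    by (simp_all add: trivial_extension_def twisted_bimodule_def)
  have "(\<zero>, a) \<in> carrier ?S" "left_morphic_elem ?S (\<zero>, a)"
    using morphic a unfolding left_morphic_ring_def by (auto simp: S)
  then obtain \<beta> where "\<beta> \<in> carrier ?S"
    and ann: "PIdl\<^bsub>?S\<^esub> (\<zero>, a) = {x \<in> carrier ?S. x \<otimes>\<^bsub>?S\<^esub> \<beta> = \<zero>\<^bsub>?S\<^esub>}"
      "PIdl\<^bsub>?S\<^esub> \<beta> = {x \<in> carrier ?S. x \<otimes>\<^bsub>?S\<^esub> (\<zero>, a) = \<zero>\<^bsub>?S\<^esub>}"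
    by (rule S.left_morphic_elem_annihilators)
  moreover then obtain b c where \<beta>: "\<beta> = (b, c)" "b \<in> carrier R" "c \<in> carrier R"
    by (auto simp: S)
  ultimately have l\<beta>: "(\<exists>s\<in>carrier R. (x, y) = (\<zero>, s \<otimes> a)) \<longleftrightarrow>
        x \<otimes> b = \<zero> \<and> x \<otimes> c \<oplus> y \<otimes> \<sigma> b = \<zero>"
    and S\<beta>: "(\<exists>s\<in>carrier R. \<exists>t\<in>carrier R. (x, y) = (s \<otimes> b, s \<otimes> c \<oplus> t \<otimes> \<sigma> b)) \<longleftrightarrow>
        x \<otimes> a = \<zero>"
    if xy: "x \<in> carrier R" "y \<in> carrier R" for x y
  proof -
    have "(x, y) \<in> PIdl\<^bsub>?S\<^esub> (\<zero>, a) \<longleftrightarrow> (\<exists>s\<in>carrier R. \<exists>t\<in>carrier R. (x, y) = (s, t) \<otimes>\<^bsub>?S\<^esub> (\<zero>, a))"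
      "(x, y) \<in> PIdl\<^bsub>?S\<^esub> \<beta> \<longleftrightarrow> (\<exists>s\<in>carrier R. \<exists>t\<in>carrier R. (x, y) = (s, t) \<otimes>\<^bsub>?S\<^esub> \<beta>)"
      unfolding cgenideal_def S by blast+
    \<comment> \<open>The summand \<open>t \<otimes> \<sigma> \<zero>\<close> vanishes, so the
      second coordinate \<open>t\<close> leaves no trace.\<close>
    moreover have "(s, t) \<otimes>\<^bsub>?S\<^esub> (\<zero>, a) = (\<zero>, s \<otimes> a)" if "s \<in> carrier R" "t \<in> carrier R" for s t
      using that a by (simp add: mult)
    ultimately have PIdl: "(x, y) \<in> PIdl\<^bsub>?S\<^esub> (\<zero>, a) \<longleftrightarrow> (\<exists>s\<in>carrier R. (x, y) = (\<zero>, s \<otimes> a))"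
      "(x, y) \<in> PIdl\<^bsub>?S\<^esub> \<beta> \<longleftrightarrow>
        (\<exists>s\<in>carrier R. \<exists>t\<in>carrier R. (x, y) = (s \<otimes> b, s \<otimes> c \<oplus> t \<otimes> \<sigma> b))"
      unfolding \<beta> mult by auto
    show "(\<exists>s\<in>carrier R. (x, y) = (\<zero>, s \<otimes> a)) \<longleftrightarrow>
        x \<otimes> b = \<zero> \<and> x \<otimes> c \<oplus> y \<otimes> \<sigma> b = \<zero>"
      unfolding PIdl(1)[symmetric] ann(1) using xy by (simp add: S \<beta> mult)
    show "(\<exists>s\<in>carrier R. \<exists>t\<in>carrier R. (x, y) = (s \<otimes> b, s \<otimes> c \<oplus> t \<otimes> \<sigma> b)) \<longleftrightarrow>
        x \<otimes> a = \<zero>"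
      unfolding PIdl(2)[symmetric] ann(2) using xy a by (auto simp: S mult)
  qed
  have "PIdl b = {x \<in> carrier R. x \<otimes> a = \<zero>}"
  proof (intro equalityI subsetI)
    fix x assume "x \<in> PIdl b"
    then obtain s where s: "s \<in> carrier R" "x = s \<otimes> b" by (auto simp: cgenideal_def)
    then show "x \<in> {x \<in> carrier R. x \<otimes> a = \<zero>}"
      using S\<beta>[of x "s \<otimes> c \<oplus> \<zero> \<otimes> \<sigma> b"] \<beta> by blast
  next
    fix x assume "x \<in> {x \<in> carrier R. x \<otimes> a = \<zero>}"
    \<comment> \<open>Annihilating \<open>(\<zero>, a)\<close> puts no condition on the second
      coordinate, so \<open>\<zero>\<close> may be chosen for it.\<close>
    then show "x \<in> PIdl b"
      using S\<beta>[of x \<zero>] by (auto simp: cgenideal_def)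
  qed
  moreover have "PIdl a = {x \<in> carrier R. x \<otimes> \<sigma> b = \<zero>}"
    using l\<beta>[of \<zero>] a \<beta> by (auto simp: cgenideal_def)
  \<comment> \<open>For the same reason \<open>(\<zero>, \<one>)\<close> annihilates
    \<open>(\<zero>, a)\<close>, so it is a left multiple \<open>(r, m)(b, c)\<close>.\<close>
  moreover obtain r m where "r \<in> carrier R" "m \<in> carrier R"
      "r \<otimes> b = \<zero>" "r \<otimes> c \<oplus> m \<otimes> \<sigma> b = \<one>"
    using S\<beta>[of \<zero> \<one>] a by auto
  moreover have "\<forall>x\<in>carrier R. \<forall>y\<in>carrier R.
    x \<otimes> b = \<zero> \<longrightarrow> x \<otimes> c \<oplus> y \<otimes> \<sigma> b = \<zero> \<longrightarrow> x = \<zero>"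
    using l\<beta> by auto
  ultimately show thesis using that[OF \<beta>(2,3)] by blast
qed

text \<open>Multiplying \<open>rc + md = 1\<close> by \<open>d = \<sigma> b\<close> from the left
  gives \<open>d = dmd\<close> once \<open>dr = 0\<close>. Then \<open>1 - dm\<close> annihilates
  \<open>d\<close>, so it equals some \<open>ya\<close>, and \<open>ad = 0\<close> turns
  \<open>a(1 - dm)\<close> into both \<open>a\<close> and \<open>aya\<close>.\<close>

lemma regular:
  assumes a: "a \<in> carrier R"
  obtains x where "x \<in> carrier R" "a \<otimes> x \<otimes> a = a"
proof -
  obtain b c r m
    where bcrm: "b \<in> carrier R" "c \<in> carrier R" "r \<in> carrier R" "m \<in> carrier R"
    and "PIdl b = {x \<in> carrier R. x \<otimes> a = \<zero>}"
    and Ra: "PIdl a = {x \<in> carrier R. x \<otimes> \<sigma> b = \<zero>}"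
    and rb: "r \<otimes> b = \<zero>" and one: "r \<otimes> c \<oplus> m \<otimes> \<sigma> b = \<one>"
    and inj: "\<forall>x\<in>carrier R. \<forall>y\<in>carrier R.
      x \<otimes> b = \<zero> \<longrightarrow> x \<otimes> c \<oplus> y \<otimes> \<sigma> b = \<zero> \<longrightarrow> x = \<zero>"
    using a by (rule annihilator_data)
  define d where "d = \<sigma> b"
  have d: "d \<in> carrier R" using bcrm by (simp add: d_def)
  \<comment> \<open>\<open>dr\<close> lies in \<open>l(b)\<close> and \<open>drc = d - dmd\<close>
    lies in \<open>Rd\<close>. As the sum is direct and \<open>c\<close> acts injectively on
    \<open>l(b)\<close>, this forces \<open>dr = 0\<close>.\<close>
  have dr: "d \<otimes> r = \<zero>"
  proof (rule inj[rule_format])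
    have "d \<otimes> r \<otimes> b = d \<otimes> (r \<otimes> b)" using d bcrm by (simp add: m_assoc)
    then show "d \<otimes> r \<otimes> b = \<zero>" using rb d by simp
    have "d \<otimes> r \<otimes> c \<oplus> (d \<otimes> m \<ominus> \<one>) \<otimes> d = d \<otimes> (r \<otimes> c \<oplus> m \<otimes> d) \<ominus> d"
      using d bcrm by algebra
    also have "\<dots> = \<zero>" using one d by (simp add: d_def[symmetric] minus_eq r_neg)
    finally show "d \<otimes> r \<otimes> c \<oplus> (d \<otimes> m \<ominus> \<one>) \<otimes> \<sigma> b = \<zero>" by (simp add: d_def)
  qed (use d bcrm in auto)
  have "d \<otimes> m \<otimes> d = d \<otimes> (r \<otimes> c \<oplus> m \<otimes> d) \<ominus> d \<otimes> r \<otimes> c"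
    using d bcrm by algebra
  then have "d \<otimes> m \<otimes> d = d" using one dr d bcrm by (simp add: d_def[symmetric] minus_eq)
  then have "(\<one> \<ominus> d \<otimes> m) \<otimes> d = \<zero>"
    using d bcrm by (simp add: minus_eq l_distr l_minus r_neg)
  then have "\<one> \<ominus> d \<otimes> m \<in> PIdl a" using d bcrm Ra by (simp add: d_def)
  then obtain y where y: "y \<in> carrier R" "\<one> \<ominus> d \<otimes> m = y \<otimes> a"
    by (auto simp: cgenideal_def)
  have "a \<in> PIdl a" using a by (rule cgenideal_self)
  then have ad: "a \<otimes> d = \<zero>" using Ra by (simp add: d_def)
  have "a \<otimes> y \<otimes> a = a \<otimes> (\<one> \<ominus> d \<otimes> m)" using y a by (simp add: m_assoc)
  also have "\<dots> = a \<ominus> a \<otimes> d \<otimes> m" using a d bcrm by (algebra; simp)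
  also have "\<dots> = a" using ad a bcrm by (simp add: minus_eq)
  finally show thesis using that y by blast
qed

text \<open>Right multiplication by \<open>\<sigma> b\<close> maps \<open>Re\<close> onto
  \<open>R\<sigma>(b)\<close>, and it is injective there because its kernel on \<open>R\<close> is
  \<open>Ra\<close>, a complement of \<open>Re\<close>. Since \<open>f\<close> and \<open>b\<close>
  are left multiples of each other, so are their images under \<open>\<sigma>\<close>.\<close>

lemma equivalent_twist:
  assumes a: "a \<in> carrier R" and x: "x \<in> carrier R" and axa: "a \<otimes> x \<otimes> a = a"
  shows "idempotents_equivalent (\<one> \<ominus> x \<otimes> a) (\<sigma> (\<one> \<ominus> a \<otimes> x))"
proof -
  define e f where "e = \<one> \<ominus> x \<otimes> a" and "f = \<one> \<ominus> a \<otimes> x"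
  have ef: "e \<in> carrier R" "f \<in> carrier R" using a x by (simp_all add: e_def f_def)
  have ae: "a \<otimes> e = \<zero>" and fa: "f \<otimes> a = \<zero>"
    using a x axa by (simp_all add: e_def f_def minus_eq r_distr l_distr r_minus l_minus
        m_assoc[symmetric] r_neg)
  have ff: "f \<otimes> f = f"
  proof -
    have "f \<otimes> f = f \<ominus> f \<otimes> a \<otimes> x" using a x unfolding f_def by (algebra; simp)
    then show ?thesis using fa ef x by (simp add: minus_eq)
  qed
  have ee: "e \<otimes> e = e"
  proof -
    have "e \<otimes> e = e \<ominus> x \<otimes> (a \<otimes> e)" using a x unfolding e_def by (algebra; simp)
    then show ?thesis using ae ef x by (simp add: minus_eq)
  qed
  obtain b where b: "b \<in> carrier R"
    and Rb: "PIdl b = {x \<in> carrier R. x \<otimes> a = \<zero>}"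
    and Ra: "PIdl a = {x \<in> carrier R. x \<otimes> \<sigma> b = \<zero>}"
    by (rule annihilator_data[OF a])
  have "f \<in> PIdl b" using Rb ef fa by simp
  then obtain w0 where w0: "w0 \<in> carrier R" "f = w0 \<otimes> b" by (auto simp: cgenideal_def)
  \<comment> \<open>The factor \<open>f\<close> makes \<open>f \<otimes> w = w\<close>, which
    \<open>\<sigma>\<close> carries over to \<open>?g\<close>.\<close>
  define w where "w = f \<otimes> w0"
  have w: "w \<in> carrier R" "f \<otimes> w = w" "w \<otimes> b = f"
  proof -
    show "w \<in> carrier R" using w0 ef by (simp add: w_def)
    have "f \<otimes> w = f \<otimes> f \<otimes> w0" using w0(1) ef by (simp only: w_def m_assoc)
    then show "f \<otimes> w = w" unfolding ff w_def .
    have "w \<otimes> b = f \<otimes> (w0 \<otimes> b)" using w0(1) ef b by (simp only: w_def m_assoc)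
    then show "w \<otimes> b = f" unfolding w0(2)[symmetric] ff .
  qed
  have "b \<in> PIdl b" using b by (rule cgenideal_self)
  then have "b \<otimes> a = \<zero>" using Rb by simp
  moreover have "b \<otimes> f = b \<ominus> b \<otimes> a \<otimes> x" using a x b unfolding f_def by (algebra; simp)
  ultimately have bf: "b \<otimes> f = b" using b x by (simp add: minus_eq)
  have "a \<in> PIdl a" using a by (rule cgenideal_self)
  then have asb: "a \<otimes> \<sigma> b = \<zero>" using Ra by simp
  \<comment> \<open>\<open>\<sigma> w\<close> already satisfies
    \<open>\<sigma> w \<otimes> ?u = ?g\<close>; the factor \<open>e\<close> projects it into
    \<open>Re\<close>.\<close>
  let ?u = "\<sigma> b" and ?v = "\<sigma> w \<otimes> e" and ?g = "\<sigma> f"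
  have eu: "e \<otimes> ?u = ?u"
  proof -
    have "e \<otimes> ?u = ?u \<ominus> x \<otimes> (a \<otimes> ?u)" using a x \<sigma>_closed[OF b] unfolding e_def by (algebra; simp)
    then show ?thesis using asb b x by (simp add: minus_eq)
  qed
  have ug: "?u \<otimes> ?g = ?u" and gw: "?g \<otimes> \<sigma> w = \<sigma> w" and wu: "\<sigma> w \<otimes> ?u = ?g"
    using ring_hom_mult[OF hom b ef(2)] ring_hom_mult[OF hom ef(2) w(1)]
      ring_hom_mult[OF hom w(1) b] bf w(2,3) by simp_all
  have gv: "?g \<otimes> ?v = ?v" and ve: "?v \<otimes> e = ?v" and vu: "?v \<otimes> ?u = ?g"
  proof -
    have "?g \<otimes> ?v = ?g \<otimes> \<sigma> w \<otimes> e" using ef w(1) by (simp only: m_assoc \<sigma>_closed)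
    then show "?g \<otimes> ?v = ?v" unfolding gw .
    have "?v \<otimes> e = \<sigma> w \<otimes> (e \<otimes> e)" using ef w(1) by (simp only: m_assoc \<sigma>_closed)
    then show "?v \<otimes> e = ?v" unfolding ee .
    have "?v \<otimes> ?u = \<sigma> w \<otimes> (e \<otimes> ?u)" using ef w(1) b by (simp only: m_assoc \<sigma>_closed)
    then show "?v \<otimes> ?u = ?g" unfolding eu wu .
  qed
  \<comment> \<open>The difference from \<open>\<one>\<close> annihilates \<open>\<sigma> b\<close>,
    hence lies in \<open>Ra\<close>, and multiplication by \<open>e\<close> kills it since
    \<open>ae = 0\<close>.\<close>
  have "(?u \<otimes> \<sigma> w \<ominus> \<one>) \<otimes> ?u = ?u \<otimes> (\<sigma> w \<otimes> ?u) \<ominus> ?u"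
    using \<sigma>_closed[OF b] \<sigma>_closed[OF w(1)] by algebra
  then have "(?u \<otimes> \<sigma> w \<ominus> \<one>) \<otimes> ?u = \<zero>" using wu ug b by (simp add: minus_eq r_neg)
  then have "?u \<otimes> \<sigma> w \<ominus> \<one> \<in> PIdl a" using Ra b w by simp
  then obtain y where y: "y \<in> carrier R" "?u \<otimes> \<sigma> w \<ominus> \<one> = y \<otimes> a"
    by (auto simp: cgenideal_def)
  have "?u \<otimes> ?v = (?u \<otimes> \<sigma> w \<ominus> \<one>) \<otimes> e \<oplus> e"
    using \<sigma>_closed[OF b] \<sigma>_closed[OF w(1)] ef by algebra
  also have "\<dots> = e" using y a ef ae by (simp add: m_assoc)
  finally have uv: "?u \<otimes> ?v = e" .
  show ?thesis
    unfolding idempotents_equivalent_def e_def[symmetric] f_def[symmetric]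
    using eu ug gv ve uv vu b w ef by (intro bexI[of _ ?u] bexI[of _ ?v]) auto
qed

lemma unit_regular: "unit_regular_ring R"
  unfolding unit_regular_ring_def
proof
  fix a assume a: "a \<in> carrier R"
  obtain x where x: "x \<in> carrier R" "a \<otimes> x \<otimes> a = a" using regular[OF a] .
  define p where "p = a \<otimes> x"
  have p: "p \<in> carrier R" "p \<otimes> p = p"
    using a x unfolding p_def by (simp_all add: m_assoc[symmetric])
  \<comment> \<open>The idempotent \<open>p\<close> is its own inner inverse, so both complementary
    idempotents in \<open>equivalent_twist\<close> become \<open>1 - ax\<close>. This removes the
    twist by \<open>\<sigma>\<close>.\<close>
  have "idempotents_equivalent (\<sigma> (\<one> \<ominus> a \<otimes> x)) (\<one> \<ominus> a \<otimes> x)"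
    using equivalent_twist[of p p] p unfolding p_def
    by (simp add: idempotents_equivalent_sym)
  with equivalent_twist[OF a x] have "idempotents_equivalent (\<one> \<ominus> x \<otimes> a) (\<one> \<ominus> a \<otimes> x)"
    by (rule idempotents_equivalent_trans) (use a x in auto)
  then show "\<exists>u\<in>Units R. a = a \<otimes> u \<otimes> a"
    by (rule unit_regular_elem_if_equivalent[OF a x])
qed

end

theorem corollary2p17:
  fixes R :: "('a, 'k) ring_scheme" and \<sigma> :: "'a \<Rightarrow> 'a"
  assumes "ring R"
    and "\<sigma> \<in> ring_hom R R"
    and "left_morphic_ring (R \<propto> twisted_bimodule R \<sigma>)"
  shows "unit_regular_ring R"
  using assms by (intro morphic_twisted_extension.unit_regular morphic_twisted_extension.intro
      morphic_twisted_extension_axioms.intro)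

end
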